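(* Let $\Theta\subset\mathbb R^p$, let $\{f(\cdot,\boldsymbol\theta):\boldsymbol\theta\in\Theta\}$ be a family of probability densities on $\mathbb R^n$ and let $\boldsymbol\theta^0$ be an interior point of $\Theta$, with Fisher information matrix $J_{\boldsymbol\theta^0}$ (see context). Let $k\le m\le p$, $\Phi\subset\mathbb R^k$, $\Psi\subset\mathbb R^m$, and let $\boldsymbol\varphi\mapsto\boldsymbol\theta(\boldsymbol\varphi)$ from $\Phi$ to $\Theta$ and $\boldsymbol\psi\mapsto\boldsymbol\theta(\boldsymbol\psi)$ from $\Psi$ to $\Theta$ be two one-to-one, continuously differentiable maps whose Jacobi matrices $\nabla_{\boldsymbol\varphi}\boldsymbol\theta(\boldsymbol\varphi)$ ($p\times k$) and $\nabla_{\boldsymbol\psi}\boldsymbol\theta(\boldsymbol\psi)$ ($p\times m$) have full rank for all $\boldsymbol\varphi\in\Phi$ and all $\boldsymbol\psi\in\Psi$, respectively, and such that $\boldsymbol\theta^0=\boldsymbol\theta(\boldsymbol\varphi^0)=\boldsymbol\theta(\boldsymbol\psi^0)$ with $\boldsymbol\varphi^0$ in the interior of $\Phi$ and $\boldsymbol\psi^0$ in the interior of $\Psi$. Suppose that the parameterizations are nested: there exists a differentiable mapping $\boldsymbol\varphi\mapsto\boldsymbol\psi(\boldsymbol\varphi)$ from $\Phi$ to $\Psi$ such that $\boldsymbol\psi(\boldsymbol\varphi^0)=\boldsymbol\psi^0$ and $\boldsymbol\theta(\boldsymbol\varphi)=\boldsymbol\theta(\boldsymbol\psi(\boldsymbol\varphi))$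 for all $\boldsymbol\varphi\in\Phi$. Then $$Q_{\boldsymbol\theta(\boldsymbol\varphi^0)}\le Q_{\boldsymbol\theta(\boldsymbol\psi^0)}.$$ In addition, for any sample size $N\geq 1$, if $U\sim\mathcal N_p\big(\boldsymbol 0,\tfrac1N Q_{\boldsymbol\theta(\boldsymbol\varphi^0)}\big)$ and $V\sim\mathcal N_p\big(\boldsymbol 0,\tfrac1N Q_{\boldsymbol\theta(\boldsymbol\psi^0)}\big)$ are random vectors (having the asymptotic distributions of the errors $\boldsymbol\theta(\hat{\boldsymbol\varphi}_N)-\boldsymbol\theta^0$ and $\boldsymbol\theta(\hat{\boldsymbol\psi}_N)-\boldsymbol\theta^0$ of the maximum likelihood estimates in the two parameterizations), then $$\mathrm E|U|^2=\frac1N\operatorname{Tr}Q_{\boldsymbol\theta(\boldsymbol\varphi^0)}\le\frac1N\operatorname{Tr}Q_{\boldsymbol\theta(\boldsymbol\psi^0)}=\mathrm E|V|^2,$$ where $|V|=(V^\top V)^{1/2}$ is the Euclidean norm in $\mathbb R^p$.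
   Context: For symmetric matrices $A,B$, $A\le B$ means that $B-A$ is positive semidefinite. Write $\ell(\boldsymbol\theta|\boldsymbol x)=\log f(\boldsymbol x,\boldsymbol\theta)$; gradients with respect to a parameter are row vectors, and $\nabla_{\boldsymbol\varphi}\boldsymbol\theta$ is the matrix with entries $\partial\theta_i/\partial\varphi_j$ (similarly for $\boldsymbol\psi$). The Fisher information matrix is $$J_{\boldsymbol\theta^0}=\mathrm E\big(\nabla_{\boldsymbol\theta}\ell(\boldsymbol\theta^0|\boldsymbol X)^\top\nabla_{\boldsymbol\theta}\ell(\boldsymbol\theta^0|\boldsymbol X)\big),\qquad\boldsymbol X\sim f(\cdot,\boldsymbol\theta^0).$$ Standing assumptions: $f(\boldsymbol x,\boldsymbol\theta_1)=f(\boldsymbol x,\boldsymbol\theta_2)$ almost surely if and only if $\boldsymbol\theta_1=\boldsymbol\theta_2$; $f$ is sufficiently smooth that $J_{\boldsymbol\theta^0}$ is well defined and finite; and $J_{\boldsymbol\theta^0}$ is invertible (hence symmetric positive definite). The matrices $Q$ are $$Q_{\boldsymbol\theta(\boldsymbol\varphi^0)}=\nabla_{\boldsymbol\varphi}\boldsymbol\theta(\boldsymbol\varphi^0)\left(\nabla_{\boldsymbol\varphi}\boldsymbol\theta(\boldsymbol\varphi^0)^\top J_{\boldsymbol\theta^0}\nabla_{\boldsymbol\varphi}\boldsymbol\theta(\boldsymbol\varphi^0)\right)^{-1}\nabla_{\boldsymbol\varphi}\boldsymbol\theta(\boldsymbol\varphi^0)^\top,$$ $$Q_{\boldsymbol\theta(\boldsymbol\psi^0)}=\nabla_{\boldsymbol\psi}\boldsymbol\theta(\boldsymbol\psi^0)\left(\nabla_{\boldsymbol\psi}\boldsymbol\theta(\boldsymbol\psi^0)^\top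 J_{\boldsymbol\theta^0}\nabla_{\boldsymbol\psi}\boldsymbol\theta(\boldsymbol\psi^0)\right)^{-1}\nabla_{\boldsymbol\psi}\boldsymbol\theta(\boldsymbol\psi^0)^\top;$$ they are the asymptotic covariance matrices of $\sqrt N(\boldsymbol\theta(\hat{\boldsymbol\varphi}_N)-\boldsymbol\theta^0)$ and $\sqrt N(\boldsymbol\theta(\hat{\boldsymbol\psi}_N)-\boldsymbol\theta^0)$, where $\hat{\boldsymbol\varphi}_N,\hat{\boldsymbol\psi}_N$ are the maximum likelihood estimators from a sample of size $N$. Normal distributions may have singular covariance. *)

theory Defs
  imports "HOL-Probability.Probability"
begin

definition psd :: "real^'n^'n \<Rightarrow> bool" where
  "psd A \<longleftrightarrow> transpose A = A \<and> (\<forall>x. 0 \<le> x \<bullet> (A *v x))"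

definition loewner_le :: "real^'n^'n \<Rightarrow> real^'n^'n \<Rightarrow> bool"  (infix "\<preceq>" 50) where
  "A \<preceq> B \<longleftrightarrow> transpose A = A \<and> transpose B = B \<and> psd (B - A)"

definition density_family :: "(real^'n \<Rightarrow> real^'p \<Rightarrow> real) \<Rightarrow> (real^'p) set \<Rightarrow> bool" where
  "density_family f \<Theta> \<longleftrightarrow>
     (\<forall>\<theta>\<in>\<Theta>. (\<lambda>x. f x \<theta>) \<in> borel_measurable lborel \<and> (\<forall>x. 0 \<le> f x \<theta>)
        \<and> prob_space (density lborel (\<lambda>x. ennreal (f x \<theta>))))"

text \<open>Almost surely is read with respect to Lebesgue measure; for probability densities this agrees
  with almost surely under either of the two distributions involved.\<close>

definition identifiable :: "(real^'n \<Rightarrow> real^'p \<Rightarrow> real) \<Rightarrow> (real^'p) set \<Rightarrow> bool" where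
  "identifiable f \<Theta> \<longleftrightarrow>
     (\<forall>\<theta>\<^sub>1\<in>\<Theta>. \<forall>\<theta>\<^sub>2\<in>\<Theta>. (AE x in lborel. f x \<theta>\<^sub>1 = f x \<theta>\<^sub>2) \<longleftrightarrow> \<theta>\<^sub>1 = \<theta>\<^sub>2)"

definition score :: "(real^'n \<Rightarrow> real^'p \<Rightarrow> real) \<Rightarrow> real^'p \<Rightarrow> real^'n \<Rightarrow> real^'p^1" where
  "score f \<theta> x = rowvector (\<chi> i. frechet_derivative (\<lambda>t. ln (f x t)) (at \<theta>) (axis i 1))"

definition fisher_information :: "(real^'n \<Rightarrow> real^'p \<Rightarrow> real) \<Rightarrow> real^'p \<Rightarrow> real^'p^'p" where
  "fisher_information f \<theta> =
     (LINT x|density lborel (\<lambda>x. ennreal (f x \<theta>)). transpose (score f \<theta> x) ** score f \<theta> x)"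

text \<open>Differentiability is required of the density rather than of its logarithm because \<^term>\<open>ln\<close>
  has a junk value at \<^term>\<open>0::real\<close>. The density is positive almost surely under its own distribution,
  and where it is positive the two requirements agree.\<close>

definition fisher_well_defined :: "(real^'n \<Rightarrow> real^'p \<Rightarrow> real) \<Rightarrow> real^'p \<Rightarrow> bool" where
  "fisher_well_defined f \<theta> \<longleftrightarrow>
     (AE x in density lborel (\<lambda>x. ennreal (f x \<theta>)). f x differentiable (at \<theta>)) \<and>
     integrable (density lborel (\<lambda>x. ennreal (f x \<theta>)))
       (\<lambda>x. transpose (score f \<theta> x) ** score f \<theta> x)"

text \<open>The domain of a parameterization is an arbitrary set, so at its non-interior points the
  derivative is taken within the domain and need not be unique there: some continuous version
  of the Jacobi matrix has to have full rank. At interior points it equals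
  \<^term>\<open>jacobian g (at a)\<close>.\<close>

definition C1_full_rank_on :: "(real^'k \<Rightarrow> real^'p) \<Rightarrow> (real^'k) set \<Rightarrow> bool" where
  "C1_full_rank_on g S \<longleftrightarrow>
     (\<exists>D :: real^'k \<Rightarrow> real^'k^'p.
        continuous_on S D \<and>
        (\<forall>a\<in>S. (g has_derivative (\<lambda>h. D a *v h)) (at a within S)
               \<and> rank (D a) = min CARD('k) CARD('p)))"

definition asymp_cov :: "(real^'k \<Rightarrow> real^'p) \<Rightarrow> real^'k \<Rightarrow> real^'p^'p \<Rightarrow> real^'p^'p" where
  "asymp_cov g a J =
     (let D = jacobian g (at a) in D ** matrix_inv (transpose D ** J ** D) ** transpose D)"

text \<open>A possibly degenerate multivariate normal distribution has no density, hence the definition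
  by the characteristic function.\<close>

definition normal_vector :: "'a measure \<Rightarrow> ('a \<Rightarrow> real^'p) \<Rightarrow> real^'p \<Rightarrow> real^'p^'p \<Rightarrow> bool" where
  "normal_vector M X \<mu> \<Sigma> \<longleftrightarrow>
     prob_space M \<and> X \<in> borel_measurable M \<and>
     (\<forall>t. (CLINT \<omega>|M. iexp (t \<bullet> X \<omega>)) =
          exp (\<i> * complex_of_real (t \<bullet> \<mu>) - complex_of_real (t \<bullet> (\<Sigma> *v t) / 2)))"

end

theory Submission
  imports Defs
begin

text \<open>With respect to the inner product given by \<open>J\<close>, the vector \<open>Q x\<close> is the projection of
  \<open>J\<^sup>-\<^sup>1 x\<close> onto the column space of the Jacobi matrix \<open>D\<close>: it lies in that space and satisfies
  \<open>z \<bullet> J Q x = z \<bullet> x\<close> for all \<open>z\<close> in it. By the chain rule the column space of the nested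
  parameterization is contained in that of the larger one, and projecting onto a smaller space
  decreases \<open>x \<bullet> Q x\<close>, which is the squared length of the projection.

  A linear functional \<open>t \<bullet> U\<close> of a centred normal vector has the distribution of a multiple of a
  standard normal variable, by Levy's uniqueness theorem; its second moment is therefore the
  quadratic form of the covariance matrix at \<open>t\<close>, and the trace is the sum over the coordinates.\<close>

section \<open>Information projections\<close>

definition pos_def :: "real^'n^'n \<Rightarrow> bool" where
  "pos_def A \<longleftrightarrow> transpose A = A \<and> (\<forall>x. x \<noteq> 0 \<longrightarrow> 0 < x \<bullet> (A *v x))"

text \<open>The Jacobi matrix \<open>D\<close> is a free variable here, so that the matrix algebra
  needs neither a map nor a base point; \<open>asymp_cov\<close> is the case where \<open>D\<close>
  is a \<open>jacobian\<close>.\<close>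

definition cov_of :: "real^'k^'p \<Rightarrow> real^'p^'p \<Rightarrow> real^'p^'p" where
  "cov_of D J = D ** matrix_inv (transpose D ** J ** D) ** transpose D"

lemma inner_transpose_matrix_vector:
  fixes A :: "real^'n^'m"
  shows "(transpose A *v x) \<bullet> y = x \<bullet> (A *v y)"
  by (simp add: dot_lmul_matrix transpose_matrix_vector)

lemma pos_def_imp_invertible:
  assumes "pos_def A"
  shows "invertible A"
proof -
  have "x = 0" if "A *v x = 0" for x
    using assms that unfolding pos_def_def by (metis inner_zero_right less_irrefl)
  then show ?thesis
    by (metis invertible_left_inverse matrix_left_invertible_ker)
qed

text \<open>A nonzero \<open>x\<close> with vanishing quadratic form would have
  \<open>A *v x\<close> nonzero, and moving from \<open>x\<close> against that direction would make
  the form negative.\<close>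

lemma psd_invertible_imp_pos_def:
  assumes "psd A" "invertible A"
  shows "pos_def A"
proof -
  have sym: "transpose A = A" and nonneg: "0 \<le> x \<bullet> (A *v x)" for x
    using assms(1) by (auto simp: psd_def)
  have "0 < x \<bullet> (A *v x)" if "x \<noteq> 0" for x
  proof (rule ccontr)
    assume "\<not> 0 < x \<bullet> (A *v x)"
    then have zero: "x \<bullet> (A *v x) = 0"
      using nonneg[of x] by simp
    define y where "y = A *v x"
    have "y \<noteq> 0"
      using that assms(2) unfolding y_def
      by (metis invertible_left_inverse matrix_left_invertible_ker)
    have xy: "x \<bullet> (A *v y) = y \<bullet> y"
      using inner_transpose_matrix_vector[of A x y] sym y_def by simp
    define c where "c = y \<bullet> (A *v y)"
    have c: "0 \<le> c"
      using nonneg c_def by simp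
    \<comment> \<open>This is the form at \<open>x - s *\<^sub>R y\<close>. Its constant term
      vanishes, so for small positive \<open>s\<close> the negative linear term dominates.\<close>
    have q: "0 \<le> c * s\<^sup>2 - 2 * s * (y \<bullet> y)" for s :: real
      using nonneg[of "x - s *\<^sub>R y"] zero xy
      by (simp add: matrix_vector_mult_diff_distrib matrix_vector_mult_scaleR inner_diff_left
          inner_diff_right c_def y_def[symmetric] power2_eq_square algebra_simps inner_commute)
    have yy: "0 < y \<bullet> y"
      using \<open>y \<noteq> 0\<close> by simp
    show False
    proof (cases "c = 0")
      case True
      then show False using q[of 1] yy by simp
    next
      case False
      \<comment> \<open>The value of \<open>s\<close> inserted here is the minimizer of the
        quadratic polynomial in \<open>q\<close>.\<close>
      have "c * ((y \<bullet> y) / c)\<^sup>2 - 2 * ((y \<bullet> y) / c) * (y \<bullet> y) = - ((y \<bullet> y)\<^sup>2 / c)"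
        using False by (simp add: power2_eq_square field_simps)
      moreover have "0 < (y \<bullet> y)\<^sup>2 / c"
        using False c yy by simp
      ultimately show False
        using q[of "(y \<bullet> y) / c"] by linarith
    qed
  qed
  with sym show ?thesis
    by (simp add: pos_def_def)
qed

text \<open>The form at \<open>x\<close> is the form of \<open>J\<close> at \<open>D *v x\<close>,
  which is nonzero by injectivity. This makes the matrix inverted in \<open>cov_of\<close>
  invertible.\<close>

lemma pos_def_congruence:
  fixes D :: "real^'k^'p"
  assumes J: "pos_def J" and D: "inj ((*v) D)"
  shows "pos_def (transpose D ** J ** D)"
proof -
  have "0 < x \<bullet> (transpose D ** J ** D *v x)" if "x \<noteq> 0" for x
  proof -
    have "D *v x \<noteq> 0"
      using D that by (metis injD matrix_vector_mult_0_right)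
    moreover have "x \<bullet> (transpose D ** J ** D *v x) = (D *v x) \<bullet> (J *v (D *v x))"
      using inner_transpose_matrix_vector[of D "J *v (D *v x)" x]
      by (simp add: matrix_vector_mul_assoc[symmetric] inner_commute)
    ultimately show ?thesis
      using J by (simp add: pos_def_def)
  qed
  then show ?thesis
    using J by (simp add: pos_def_def matrix_transpose_mul matrix_mul_assoc)
qed

lemma matrix_inv_right:
  fixes A :: "real^'n^'n"
  assumes "invertible A"
  shows "A ** matrix_inv A = mat 1"
  using someI_ex[OF assms[unfolded invertible_def]] by (simp add: matrix_inv_def)

text \<open>Transposing the right inverse law shows that the transposed inverse is a left inverse,
  and a left inverse coincides with a right inverse.\<close>

lemma symmetric_matrix_inv:
  fixes A :: "real^'n^'n"
  assumes "transpose A = A" "invertible A"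
  shows "transpose (matrix_inv A) = matrix_inv A"
proof -
  have "transpose (matrix_inv A) ** A = mat 1"
    using arg_cong[OF matrix_inv_right[OF assms(2)], of transpose] assms(1)
    by (simp add: matrix_transpose_mul)
  then have "transpose (matrix_inv A) ** (A ** matrix_inv A) = matrix_inv A"
    by (simp add: matrix_mul_assoc)
  then show ?thesis
    by (simp add: matrix_inv_right[OF assms(2)])
qed

lemma transpose_cov_of:
  fixes D :: "real^'k^'p"
  assumes "pos_def J" "inj ((*v) D)"
  shows "transpose (cov_of D J) = cov_of D J"
proof -
  have A: "pos_def (transpose D ** J ** D)"
    by (rule pos_def_congruence[OF assms])
  then have "transpose (matrix_inv (transpose D ** J ** D)) = matrix_inv (transpose D ** J ** D)"
    by (intro symmetric_matrix_inv pos_def_imp_invertible) (simp_all add: pos_def_def)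
  then show ?thesis
    by (simp add: cov_of_def matrix_transpose_mul matrix_mul_assoc)
qed

lemma cov_of_mult_vector:
  "cov_of D J *v x = D *v (matrix_inv (transpose D ** J ** D) *v (transpose D *v x))"
  by (simp only: cov_of_def matrix_vector_mul_assoc matrix_mul_assoc)

text \<open>Pairing with \<open>D *v u\<close> amounts to applying \<open>transpose D\<close>, after
  which \<open>transpose D ** J ** D\<close> cancels against its inverse inside
  \<open>cov_of\<close>.\<close>

lemma cov_of_projection:
  fixes D :: "real^'k^'p"
  assumes "pos_def J" "inj ((*v) D)"
  shows "(D *v u) \<bullet> (J *v (cov_of D J *v x)) = (D *v u) \<bullet> x"
proof -
  let ?A = "transpose D ** J ** D"
  have inv: "?A ** matrix_inv ?A = mat 1"
    using assms by (intro matrix_inv_right pos_def_imp_invertible pos_def_congruence)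
  have "(D *v u) \<bullet> (J *v (cov_of D J *v x)) = u \<bullet> (transpose D *v (J *v (cov_of D J *v x)))"
    using inner_transpose_matrix_vector[of D _ u] by (simp add: inner_commute)
  also have "transpose D *v (J *v (cov_of D J *v x)) = (?A ** matrix_inv ?A) *v (transpose D *v x)"
    by (simp add: cov_of_mult_vector matrix_vector_mul_assoc matrix_mul_assoc)
  also have "\<dots> = transpose D *v x"
    by (simp add: inv)
  also have "u \<bullet> (transpose D *v x) = (D *v u) \<bullet> x"
    using inner_transpose_matrix_vector[of D x u] by (simp add: inner_commute)
  finally show ?thesis .
qed

lemma psd_cov_of:
  fixes D :: "real^'k^'p"
  assumes "pos_def J" "inj ((*v) D)"
  shows "psd (cov_of D J)"
proof -
  have "0 \<le> x \<bullet> (cov_of D J *v x)" for x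
  proof -
    let ?w = "cov_of D J *v x"
    \<comment> \<open>The vector \<open>?w\<close> lies in the column space of \<open>D\<close>, so
      it can serve as its own test vector in the projection property.\<close>
    have "x \<bullet> ?w = ?w \<bullet> (J *v ?w)"
      using cov_of_projection[OF assms, of _ x] cov_of_mult_vector[of D J x]
      by (metis inner_commute)
    also have "0 \<le> \<dots>"
      using assms(1) unfolding pos_def_def by (metis inner_zero_left less_imp_le order_refl)
    finally show ?thesis .
  qed
  then show ?thesis
    using transpose_cov_of[OF assms] by (simp add: psd_def)
qed

text \<open>Pythagoras in the inner product of \<open>J\<close>: the difference of the two quadratic
  forms at \<open>x\<close> is the squared length of the difference of the two projections.\<close>

lemma cov_of_mono:
  fixes D :: "real^'m^'p" and B :: "real^'k^'m"
  assumes J: "pos_def J" and D: "inj ((*v) D)" and DB: "inj ((*v) (D ** B))"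
  shows "cov_of (D ** B) J \<preceq> cov_of D J"
proof -
  have "0 \<le> x \<bullet> ((cov_of D J - cov_of (D ** B) J) *v x)" for x
  proof -
    let ?v = "cov_of (D ** B) J *v x" and ?w = "cov_of D J *v x"
    obtain a b where a: "?v = (D ** B) *v a" and b: "?w = D *v b"
      using cov_of_mult_vector by metis
    have v: "?v = D *v (B *v a)"
      using a by (simp add: matrix_vector_mul_assoc)
    have vv: "?v \<bullet> (J *v ?v) = ?v \<bullet> x"
      using cov_of_projection[OF J DB, of a x] a by simp
    \<comment> \<open>Nesting enters here: \<open>?v\<close> also lies in the column space of
      \<open>D\<close>, hence is a legitimate test vector for the larger projection.\<close>
    have vw: "?v \<bullet> (J *v ?w) = ?v \<bullet> x"
      using cov_of_projection[OF J D, of "B *v a" x] v by simp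
    have ww: "?w \<bullet> (J *v ?w) = ?w \<bullet> x"
      using cov_of_projection[OF J D, of b x] b by simp
    have wv: "?w \<bullet> (J *v ?v) = ?v \<bullet> x"
      using vw J inner_transpose_matrix_vector[of J ?w ?v] by (simp add: pos_def_def inner_commute)
    have "0 \<le> (?w - ?v) \<bullet> (J *v (?w - ?v))"
      using J unfolding pos_def_def by (metis inner_zero_left less_imp_le order_refl)
    also have "\<dots> = ?w \<bullet> x - ?v \<bullet> x"
      by (simp only: matrix_vector_mult_diff_distrib inner_diff_left inner_diff_right vv vw ww wv)
    also have "\<dots> = x \<bullet> ((cov_of D J - cov_of (D ** B) J) *v x)"
      by (simp add: matrix_vector_mult_diff_rdistrib inner_diff_right inner_commute)
    finally show ?thesis .
  qed
  moreover have "transpose (cov_of D J - cov_of (D ** B) J) = cov_of D J - cov_of (D ** B) J"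
    using arg_cong[OF transpose_cov_of[OF J D], of "\<lambda>M. M $ _ $ _"]
      arg_cong[OF transpose_cov_of[OF J DB], of "\<lambda>M. M $ _ $ _"]
    by (simp add: vec_eq_iff transpose_def)
  ultimately show ?thesis
    using transpose_cov_of[OF J D] transpose_cov_of[OF J DB] by (simp add: loewner_le_def psd_def)
qed

lemma inner_axis_matrix:
  fixes A :: "real^'n^'m"
  shows "axis i 1 \<bullet> (A *v axis j 1) = A $ i $ j"
  by (simp add: inner_axis' matrix_vector_mult_basis column_def)

text \<open>The quadratic form of the difference at a coordinate vector is a diagonal entry.\<close>

lemma loewner_le_trace:
  assumes "A \<preceq> B"
  shows "trace A \<le> trace B"
  unfolding trace_def
proof (rule sum_mono)
  fix i
  have "0 \<le> axis i 1 \<bullet> ((B - A) *v axis i 1)"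
    using assms unfolding loewner_le_def psd_def by blast
  then show "A $ i $ i \<le> B $ i $ i"
    by (simp only: inner_axis_matrix) simp
qed

section \<open>Fisher information and Jacobi matrices\<close>

text \<open>The integrand is a Gram matrix at every point. Entries and quadratic forms are bounded
  linear in the matrix, so they commute with the Bochner integral, and symmetry and nonnegativity
  carry over.\<close>

lemma fisher_information_psd:
  fixes f :: "real^'n \<Rightarrow> real^'p \<Rightarrow> real"
  assumes "fisher_well_defined f \<theta>"
  shows "psd (fisher_information f \<theta>)"
proof -
  let ?M = "density lborel (\<lambda>x. ennreal (f x \<theta>))"
  let ?G = "\<lambda>x. transpose (score f \<theta> x) ** score f \<theta> x"
  have int: "integrable ?M ?G"
    using assms by (simp add: fisher_well_defined_def)
  have entry: "bounded_linear (\<lambda>A :: real^'p^'p. A $ i $ j)" for i j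
    by (intro bounded_linear_compose[OF bounded_linear_vec_nth bounded_linear_vec_nth])
  have "fisher_information f \<theta> $ i $ j = fisher_information f \<theta> $ j $ i" for i j
  proof -
    have "?G x $ i $ j = ?G x $ j $ i" for x
      by (simp add: matrix_matrix_mult_def transpose_def mult.commute)
    then show ?thesis
      by (simp add: fisher_information_def integral_bounded_linear[OF entry int, symmetric])
  qed
  moreover have "0 \<le> y \<bullet> (fisher_information f \<theta> *v y)" for y
  proof -
    have lin: "bounded_linear (\<lambda>A :: real^'p^'p. y \<bullet> (A *v y))"
      unfolding linear_conv_bounded_linear[symmetric]
      by (rule linearI) (simp_all add: matrix_vector_mult_add_rdistrib inner_add_right
          scaleR_matrix_vector_assoc[symmetric])
    have "y \<bullet> (?G x *v y) = (score f \<theta> x *v y) \<bullet> (score f \<theta> x *v y)" for x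
      using inner_transpose_matrix_vector[of "score f \<theta> x" "score f \<theta> x *v y" y]
      by (simp add: matrix_vector_mul_assoc[symmetric] inner_commute)
    then show ?thesis
      by (simp add: fisher_information_def integral_bounded_linear[OF lin int, symmetric])
  qed
  ultimately show ?thesis
    by (simp add: psd_def vec_eq_iff transpose_def)
qed

lemma jacobian_eq:
  fixes g :: "real^'k \<Rightarrow> real^'p"
  assumes "(g has_derivative (\<lambda>h. D *v h)) (at a)"
  shows "jacobian g (at a) = D"
  using frechet_derivative_at[OF assms, symmetric] by (simp add: jacobian_def)

text \<open>At an interior point the derivative within \<open>S\<close> is the ordinary one and
  hence unique, so the Jacobi matrix provided by \<open>C1_full_rank_on\<close> is
  \<open>jacobian g (at a)\<close>. With no more columns than rows, full rank means
  injectivity.\<close>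

lemma C1_full_rank_on_interior:
  fixes g :: "real^'k \<Rightarrow> real^'p"
  assumes "C1_full_rank_on g S" "a \<in> interior S" "CARD('k) \<le> CARD('p)"
  shows "(g has_derivative (\<lambda>h. jacobian g (at a) *v h)) (at a)"
    and "inj ((*v) (jacobian g (at a)))"
proof -
  have "a \<in> S"
    using assms(2) interior_subset by blast
  obtain D where "\<forall>a\<in>S. (g has_derivative (\<lambda>h. D a *v h)) (at a within S)
      \<and> rank (D a) = min CARD('k) CARD('p)"
    using assms(1) unfolding C1_full_rank_on_def by blast
  with \<open>a \<in> S\<close> assms(3)
  have "(g has_derivative (\<lambda>h. D a *v h)) (at a within S)" and rank: "rank (D a) = CARD('k)"
    by (simp_all add: min_absorb1)
  then have D: "(g has_derivative (\<lambda>h. D a *v h)) (at a)"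
    by (simp only: at_within_interior[OF assms(2)])
  have "inj ((*v) (D a))"
    using rank by (rule full_rank_injective[THEN iffD1])
  with D jacobian_eq[OF D]
  show "(g has_derivative (\<lambda>h. jacobian g (at a) *v h)) (at a)" "inj ((*v) (jacobian g (at a)))"
    by simp_all
qed

section \<open>Second moments of normal vectors\<close>

text \<open>The characteristic function of \<open>t \<bullet> X\<close> at \<open>u\<close> is that
  of \<open>X\<close> at \<open>u *\<^sub>R t\<close>. Scaling a standard normal variable, rather
  than using a normal density, also covers variance zero.\<close>

lemma normal_vector_inner_distr:
  assumes X: "normal_vector M X 0 \<Sigma>" and pos: "0 \<le> t \<bullet> (\<Sigma> *v t)"
  shows "distr M borel (\<lambda>\<omega>. t \<bullet> X \<omega>) =
    distr std_normal_distribution borel ((*) (sqrt (t \<bullet> (\<Sigma> *v t))))"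
proof (rule Levy_uniqueness)
  let ?s = "sqrt (t \<bullet> (\<Sigma> *v t))"
  interpret M: prob_space M
    using X by (simp add: normal_vector_def)
  interpret S: real_distribution std_normal_distribution
    by (rule real_dist_normal_dist)
  have [measurable]: "X \<in> borel_measurable M"
    using X by (simp add: normal_vector_def)
  show "real_distribution (distr M borel (\<lambda>\<omega>. t \<bullet> X \<omega>))"
    by (rule M.real_distribution_distr) simp
  show "real_distribution (distr std_normal_distribution borel ((*) ?s))"
    by (rule S.real_distribution_distr) simp
  show "char (distr M borel (\<lambda>\<omega>. t \<bullet> X \<omega>)) = char (distr std_normal_distribution borel ((*) ?s))"
  proof
    fix u :: real
    have "char (distr M borel (\<lambda>\<omega>. t \<bullet> X \<omega>)) u = (CLINT \<omega>|M. iexp ((u *\<^sub>R t) \<bullet> X \<omega>))"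
      unfolding char_def by (subst integral_distr) simp_all
    also have "\<dots> = exp (- complex_of_real ((u *\<^sub>R t) \<bullet> (\<Sigma> *v (u *\<^sub>R t)) / 2))"
      using X unfolding normal_vector_def by (simp only: inner_zero_right) simp
    also have "(u *\<^sub>R t) \<bullet> (\<Sigma> *v (u *\<^sub>R t)) = (u * ?s)\<^sup>2"
      using pos by (simp add: matrix_vector_mult_scaleR power_mult_distrib) (simp add: power2_eq_square)
    also have "exp (- complex_of_real ((u * ?s)\<^sup>2 / 2)) = char std_normal_distribution (u * ?s)"
      by (simp add: char_std_normal_distribution exp_of_real[symmetric])
    also have "\<dots> = char (distr std_normal_distribution borel ((*) ?s)) u"
      unfolding char_def by (subst integral_distr) (simp_all add: mult.assoc)
    finally show "char (distr M borel (\<lambda>\<omega>. t \<bullet> X \<omega>)) u =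
      char (distr std_normal_distribution borel ((*) ?s)) u" .
  qed
qed

lemma normal_vector_inner_second_moment:
  assumes X: "normal_vector M X 0 \<Sigma>" and pos: "0 \<le> t \<bullet> (\<Sigma> *v t)"
  shows "has_bochner_integral M (\<lambda>\<omega>. (t \<bullet> X \<omega>)\<^sup>2) (t \<bullet> (\<Sigma> *v t))"
proof -
  let ?s = "sqrt (t \<bullet> (\<Sigma> *v t))"
  have [measurable]: "X \<in> borel_measurable M"
    using X by (simp add: normal_vector_def)
  \<comment> \<open>Index 1 of the even moments is the exponent 2, with value
    \<open>fact 2 / (2 * fact 1)\<close>, that is 1.\<close>
  have "has_bochner_integral std_normal_distribution (\<lambda>x. x\<^sup>2) 1"
    using std_normal_distribution_even_moments[of 1] by (simp add: has_bochner_integral_iff)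
  then have "has_bochner_integral std_normal_distribution (\<lambda>x. ?s\<^sup>2 * x\<^sup>2) (?s\<^sup>2 * 1)"
    by (rule has_bochner_integral_mult_right)
  then have "has_bochner_integral std_normal_distribution (\<lambda>x. (?s * x)\<^sup>2) (t \<bullet> (\<Sigma> *v t))"
    using pos by (simp add: power_mult_distrib)
  then have "has_bochner_integral (distr std_normal_distribution borel ((*) ?s)) (\<lambda>x. x\<^sup>2)
      (t \<bullet> (\<Sigma> *v t))"
    by (subst has_bochner_integral_distr) simp_all
  then have "has_bochner_integral (distr M borel (\<lambda>\<omega>. t \<bullet> X \<omega>)) (\<lambda>x. x\<^sup>2) (t \<bullet> (\<Sigma> *v t))"
    by (simp only: normal_vector_inner_distr[OF X pos])
  then show ?thesis
    by (simp add: has_bochner_integral_iff integrable_distr_eq integral_distr)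
qed

text \<open>The squared norm is the sum of the squared coordinates, whose expectations are the
  diagonal entries of the covariance; they add up whether or not the coordinates are
  independent.\<close>

lemma normal_vector_norm_second_moment:
  assumes X: "normal_vector M X 0 \<Sigma>" and "psd \<Sigma>"
  shows "has_bochner_integral M (\<lambda>\<omega>. (norm (X \<omega>))\<^sup>2) (trace \<Sigma>)"
proof -
  have "has_bochner_integral M (\<lambda>\<omega>. \<Sum>i\<in>UNIV. (axis i 1 \<bullet> X \<omega>)\<^sup>2)
      (\<Sum>i\<in>UNIV. axis i 1 \<bullet> (\<Sigma> *v axis i 1))"
    using assms by (intro has_bochner_integral_sum normal_vector_inner_second_moment)
      (simp_all add: psd_def)
  moreover have "(norm v)\<^sup>2 = (\<Sum>i\<in>UNIV. (axis i 1 \<bullet> v)\<^sup>2)" for v :: "real^'b"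
    by (simp add: power2_norm_eq_inner inner_axis') (simp add: inner_vec_def power2_eq_square)
  ultimately show ?thesis
    by (simp only: inner_axis_matrix trace_def)
qed

lemma normal_vector_scaled_norm_second_moment:
  assumes X: "normal_vector M X 0 (c *\<^sub>R Q)" and "psd Q" and "0 \<le> c"
  shows "has_bochner_integral M (\<lambda>\<omega>. (norm (X \<omega>))\<^sup>2) (c * trace Q)"
proof -
  have "psd (c *\<^sub>R Q)"
    using assms(2,3) by (simp add: psd_def transpose_scalar scaleR_matrix_vector_assoc[symmetric])
  moreover have "trace (c *\<^sub>R Q) = c * trace Q"
    by (simp add: trace_def sum_distrib_left)
  ultimately show ?thesis
    using normal_vector_norm_second_moment[OF X] by simp
qed

theorem theorem4:
  fixes f :: "real^'n \<Rightarrow> real^'p \<Rightarrow> real"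
    and \<Theta> :: "(real^'p) set" and \<theta>0 :: "real^'p"
    and \<Phi> :: "(real^'k) set" and \<phi>0 :: "real^'k" and \<theta>\<^sub>\<phi> :: "real^'k \<Rightarrow> real^'p"
    and \<Psi> :: "(real^'m) set" and \<psi>0 :: "real^'m" and \<theta>\<^sub>\<psi> :: "real^'m \<Rightarrow> real^'p"
    and \<psi> :: "real^'k \<Rightarrow> real^'m"
  assumes "density_family f \<Theta>"
    and "identifiable f \<Theta>"
    and "\<theta>0 \<in> interior \<Theta>"
    and "fisher_well_defined f \<theta>0"
    and "invertible (fisher_information f \<theta>0)"
    and "CARD('k) \<le> CARD('m)" and "CARD('m) \<le> CARD('p)"
    and "\<theta>\<^sub>\<phi> ` \<Phi> \<subseteq> \<Theta>" and "inj_on \<theta>\<^sub>\<phi> \<Phi>" and "C1_full_rank_on \<theta>\<^sub>\<phi> \<Phi>"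
    and "\<theta>\<^sub>\<psi> ` \<Psi> \<subseteq> \<Theta>" and "inj_on \<theta>\<^sub>\<psi> \<Psi>" and "C1_full_rank_on \<theta>\<^sub>\<psi> \<Psi>"
    and "\<phi>0 \<in> interior \<Phi>" and "\<theta>\<^sub>\<phi> \<phi>0 = \<theta>0"
    and "\<psi>0 \<in> interior \<Psi>" and "\<theta>\<^sub>\<psi> \<psi>0 = \<theta>0"
    and "\<psi> ` \<Phi> \<subseteq> \<Psi>" and "\<psi> differentiable_on \<Phi>" and "\<psi> \<phi>0 = \<psi>0"
    and "\<forall>\<phi>\<in>\<Phi>. \<theta>\<^sub>\<phi> \<phi> = \<theta>\<^sub>\<psi> (\<psi> \<phi>)"
  shows "let J = fisher_information f \<theta>0;
             Q\<^sub>\<phi> = asymp_cov \<theta>\<^sub>\<phi> \<phi>0 J;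
             Q\<^sub>\<psi> = asymp_cov \<theta>\<^sub>\<psi> \<psi>0 J
         in Q\<^sub>\<phi> \<preceq> Q\<^sub>\<psi> \<and>
            (\<forall>(N::nat) (M\<^sub>U :: 'a measure) (M\<^sub>V :: 'b measure) U V. N \<ge> 1 \<longrightarrow>
               normal_vector M\<^sub>U U 0 ((1 / real N) *\<^sub>R Q\<^sub>\<phi>) \<longrightarrow>
               normal_vector M\<^sub>V V 0 ((1 / real N) *\<^sub>R Q\<^sub>\<psi>) \<longrightarrow>
               integrable M\<^sub>U (\<lambda>\<omega>. (norm (U \<omega>))\<^sup>2) \<and>
               integrable M\<^sub>V (\<lambda>\<omega>. (norm (V \<omega>))\<^sup>2) \<and>
               (LINT \<omega>|M\<^sub>U. (norm (U \<omega>))\<^sup>2) = 1 / real N * trace Q\<^sub>\<phi> \<and>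
               1 / real N * trace Q\<^sub>\<phi> \<le> 1 / real N * trace Q\<^sub>\<psi> \<and>
               1 / real N * trace Q\<^sub>\<psi> = (LINT \<omega>|M\<^sub>V. (norm (V \<omega>))\<^sup>2))"
proof -
  let ?J = "fisher_information f \<theta>0"
  let ?D\<^sub>\<phi> = "jacobian \<theta>\<^sub>\<phi> (at \<phi>0)"
    and ?D\<^sub>\<psi> = "jacobian \<theta>\<^sub>\<psi> (at \<psi>0)"
    and ?B = "jacobian \<psi> (at \<phi>0)"
  have J: "pos_def ?J"
    using assms(4,5) by (intro psd_invertible_imp_pos_def fisher_information_psd)
  have "CARD('k) \<le> CARD('p)"
    using assms(6,7) by simp
  note \<phi> = C1_full_rank_on_interior[OF assms(10,14) this]
  note \<psi> = C1_full_rank_on_interior[OF assms(13,16) assms(7)]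
  \<comment> \<open>Differentiability on \<open>\<Phi>\<close> is only within that set; interiority
    of \<open>\<phi>0\<close> turns it into differentiability at the point.\<close>
  have "\<psi> differentiable (at \<phi>0)"
    using assms(14,19) interior_subset unfolding differentiable_on_def
    by (metis at_within_interior subsetD)
  then have "(\<psi> has_derivative (\<lambda>h. ?B *v h)) (at \<phi>0)"
    by (simp add: jacobian_works)
  then have "((\<lambda>x. \<theta>\<^sub>\<psi> (\<psi> x)) has_derivative (\<lambda>h. ?D\<^sub>\<psi> *v (?B *v h))) (at \<phi>0)"
    by (rule has_derivative_compose) (use \<psi>(1) assms(20) in simp)
  \<comment> \<open>The composite agrees with \<open>\<theta>\<^sub>\<phi>\<close> on
    \<open>\<Phi>\<close> only, so the derivative is transferred on the open set
    \<open>interior \<Phi>\<close>.\<close>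
  then have "(\<theta>\<^sub>\<phi> has_derivative (\<lambda>h. (?D\<^sub>\<psi> ** ?B) *v h)) (at \<phi>0)"
    unfolding matrix_vector_mul_assoc
    by (rule has_derivative_transform_within_open[OF _ open_interior assms(14)])
      (use assms(21) interior_subset in force)
  then have D: "?D\<^sub>\<phi> = ?D\<^sub>\<psi> ** ?B"
    by (rule jacobian_eq)
  have cov: "asymp_cov \<theta>\<^sub>\<phi> \<phi>0 ?J = cov_of ?D\<^sub>\<phi> ?J" "asymp_cov \<theta>\<^sub>\<psi> \<psi>0 ?J = cov_of ?D\<^sub>\<psi> ?J"
    by (simp_all add: asymp_cov_def cov_of_def Let_def)
  \<comment> \<open>Injectivity of the product \<open>?D\<^sub>\<psi> ** ?B\<close> is the full rank
    of \<open>?D\<^sub>\<phi>\<close>, read through the factorization \<open>D\<close>.\<close>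
  have le: "cov_of ?D\<^sub>\<phi> ?J \<preceq> cov_of ?D\<^sub>\<psi> ?J"
    using cov_of_mono[OF J \<psi>(2), of ?B] \<phi>(2) D by simp
  show ?thesis
    unfolding Let_def cov
  proof (intro conjI allI impI le)
    fix N :: nat and M\<^sub>U :: "'a measure" and M\<^sub>V :: "'b measure" and U V
    assume "normal_vector M\<^sub>U U 0 ((1 / real N) *\<^sub>R cov_of ?D\<^sub>\<phi> ?J)"
      and "normal_vector M\<^sub>V V 0 ((1 / real N) *\<^sub>R cov_of ?D\<^sub>\<psi> ?J)"
    note moments = this[THEN normal_vector_scaled_norm_second_moment]
    show "integrable M\<^sub>U (\<lambda>\<omega>. (norm (U \<omega>))\<^sup>2)"
      and "(LINT \<omega>|M\<^sub>U. (norm (U \<omega>))\<^sup>2) = 1 / real N * trace (cov_of ?D\<^sub>\<phi> ?J)"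
      using moments(1)[OF psd_cov_of[OF J \<phi>(2)]] by (simp_all add: has_bochner_integral_iff)
    show "integrable M\<^sub>V (\<lambda>\<omega>. (norm (V \<omega>))\<^sup>2)"
      and "1 / real N * trace (cov_of ?D\<^sub>\<psi> ?J) = (LINT \<omega>|M\<^sub>V. (norm (V \<omega>))\<^sup>2)"
      using moments(2)[OF psd_cov_of[OF J \<psi>(2)]] by (simp_all add: has_bochner_integral_iff)
    show "1 / real N * trace (cov_of ?D\<^sub>\<phi> ?J) \<le> 1 / real N * trace (cov_of ?D\<^sub>\<psi> ?J)"
      by (intro mult_left_mono loewner_le_trace le) simp
  qed
qed

end
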